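(* Let $\sigma$ be as in the context, with the exponent $\alpha$ of condition $(\Sigma 3)$ satisfying $\alpha>1$, and assume in addition that $M_1(\phi_\sigma')<+\infty$. Let $f\in C(I)$ be such that $$\|F_n(f,\cdot)-f(\cdot)\|_\infty=\mathcal O(n^{-\nu}),\qquad n\to+\infty,$$ for some $0<\nu<1$. Then $f\in Lip(\nu)$.
   Context: $\sigma:\mathbb R\to\mathbb R$ is a non-decreasing sigmoidal function ($\lim_{x\to-\infty}\sigma(x)=0$, $\lim_{x\to+\infty}\sigma(x)=1$) satisfying: $(\Sigma1)$ $\sigma(x)-1/2$ is an odd function; $(\Sigma2)$ $\sigma\in C^2(\mathbb R)$ and $\sigma$ is concave on $[0,+\infty)$; $(\Sigma3)$ $\sigma(x)=\mathcal O(|x|^{-1-\alpha})$ as $x\to-\infty$, for some $\alpha>0$. Set $\phi_\sigma(x):=\frac12[\sigma(x+1)-\sigma(x-1)]$, $x\in\mathbb R$, and $\Psi_\sigma(\mathbf x):=\prod_{i=1}^d\phi_\sigma(x_i)$ for $\mathbf x=(x_1,\dots,x_d)\in\mathbb R^d$. For a function $g:\mathbb R\to\mathbb R$ and $\beta\ge0$, $M_\beta(g):=\sup_{x\in\mathbb R}\sum_{k\in\mathbb Z}|g(x-k)|\,|k-x|^\beta$. Let $I=\prod_{i=1}^d[a_i,b_i]$ with $a_i<b_i$ real; $C(I)$ is the space of continuous real functions on $I$ with the sup-norm $\|\cdot\|_\infty$. Let $\mathcal J_n:=\{\mathbf k\in\mathbb Z^d:\lceil na_i\rceil\le k_i\le\lfloor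 nb_i\rfloor,\ i=1,\dots,d\}$. For $f:I\to\mathbb R$ bounded and $n\in\mathbb N^+$, the neural network operators are $$F_n(f,\mathbf x):=\frac{\sum_{\mathbf k\in\mathcal J_n}f(\mathbf k/n)\Psi_\sigma(n\mathbf x-\mathbf k)}{\sum_{\mathbf k\in\mathcal J_n}\Psi_\sigma(n\mathbf x-\mathbf k)},\qquad \mathbf x\in I.$$ The modulus of continuity is $\omega(f,\delta):=\sup\{|f(\mathbf x)-f(\mathbf y)|:\mathbf x,\mathbf y\in I,\ \|\mathbf x-\mathbf y\|_2\le\delta\}$, $\delta>0$, and for $0<\nu\le1$, $Lip(\nu):=\{f\in C(I):\omega(f,\delta)=\mathcal O(\delta^\nu)\text{ as }\delta\to0^+\}$. *)

theory Defs
  imports "HOL-Analysis.Analysis" "HOL-Library.Landau_Symbols"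
begin

definition sigmoidal :: "(real \<Rightarrow> real) \<Rightarrow> bool" where
  "sigmoidal \<sigma> \<longleftrightarrow> mono \<sigma> \<and> (\<sigma> \<longlongrightarrow> 0) at_bot \<and> (\<sigma> \<longlongrightarrow> 1) at_top"

definition sigma_conditions :: "(real \<Rightarrow> real) \<Rightarrow> real \<Rightarrow> bool" where
  "sigma_conditions \<sigma> \<alpha> \<longleftrightarrow>
     sigmoidal \<sigma>
     \<and> (\<forall>x. \<sigma> (-x) - 1/2 = - (\<sigma> x - 1/2))
     \<and> (\<forall>x. \<sigma> differentiable (at x))
     \<and> (\<forall>x. deriv \<sigma> differentiable (at x))
     \<and> continuous_on UNIV (deriv (deriv \<sigma>))
     \<and> concave_on {0..} \<sigma>
     \<and> \<alpha> > 0
     \<and> \<sigma> \<in> O[at_bot](\<lambda>x. \<bar>x\<bar> powr (-1 - \<alpha>))"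

definition phi_sigma :: "(real \<Rightarrow> real) \<Rightarrow> real \<Rightarrow> real" where
  "phi_sigma \<sigma> x = (\<sigma> (x + 1) - \<sigma> (x - 1)) / 2"

definition Psi_sigma :: "(real \<Rightarrow> real) \<Rightarrow> real^'d \<Rightarrow> real" where
  "Psi_sigma \<sigma> x = (\<Prod>i\<in>UNIV. phi_sigma \<sigma> (x $ i))"

text \<open>Discrete absolute moment M_beta(g), valued in ennreal (so "< top" means finite).
  The factor |k-x|^beta is read with the convention 0^0 = 1.\<close>
definition M_moment :: "real \<Rightarrow> (real \<Rightarrow> real) \<Rightarrow> ennreal" where
  "M_moment \<beta> g = (SUP x::real. \<Sum>\<^sub>\<infinity>k::int.
      ennreal (\<bar>g (x - of_int k)\<bar> * (if \<beta> = 0 then 1 else \<bar>of_int k - x\<bar> powr \<beta>)))"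

definition J_set :: "real^'d \<Rightarrow> real^'d \<Rightarrow> nat \<Rightarrow> (real^'d) set" where
  "J_set a b n = {k. \<forall>i. k $ i \<in> \<int> \<and> of_int \<lceil>real n * a $ i\<rceil> \<le> k $ i \<and> k $ i \<le> of_int \<lfloor>real n * b $ i\<rfloor>}"

definition F_op :: "(real \<Rightarrow> real) \<Rightarrow> real^'d \<Rightarrow> real^'d \<Rightarrow> nat \<Rightarrow> (real^'d \<Rightarrow> real) \<Rightarrow> real^'d \<Rightarrow> real" where
  "F_op \<sigma> a b n f x =
     (\<Sum>k\<in>J_set a b n. f ((1 / real n) *\<^sub>R k) * Psi_sigma \<sigma> (real n *\<^sub>R x - k))
     / (\<Sum>k\<in>J_set a b n. Psi_sigma \<sigma> (real n *\<^sub>R x - k))"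

definition modulus :: "(real^'d \<Rightarrow> real) \<Rightarrow> (real^'d) set \<Rightarrow> real \<Rightarrow> real" where
  "modulus f I \<delta> = (SUP p\<in>{(x, y). x \<in> I \<and> y \<in> I \<and> dist x y \<le> \<delta>}. \<bar>f (fst p) - f (snd p)\<bar>)"

definition Lip_class :: "(real^'d) set \<Rightarrow> real \<Rightarrow> (real^'d \<Rightarrow> real) set" where
  "Lip_class I \<nu> = {f. continuous_on I f \<and> modulus f I \<in> O[at_right 0](\<lambda>\<delta>. \<delta> powr \<nu>)}"

end

theory Submission
  imports Defs
begin

text \<open>
  A Bernstein-type estimate \<open>\<bar>F_n f x - F_n f y\<bar> \<le> L * n * \<bar>x - y\<bar> * \<omega> (f, 1 / n)\<close>,
  which rests on the finiteness of the first moments of \<open>\<phi>\<close> (because \<open>\<alpha> > 1\<close>) and of \<open>\<phi>'\<close>,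
  combines with the assumed rate \<open>\<parallel>F_n f - f\<parallel> = O (n powr (-\<nu>))\<close> to the recursion
  \<open>\<omega> (f, \<delta>) \<le> 2 * C * n powr (-\<nu>) + L * n * \<delta> * \<omega> (f, 1 / n)\<close> for all large \<open>n\<close> and all
  \<open>\<delta> > 0\<close>. For \<open>\<nu> < 1\<close> this recursion forces \<open>\<omega> (f, \<delta>) = O (\<delta> powr \<nu>)\<close>.
\<close>

section \<open>Modulus of continuity and the Berens--Lorentz recursion\<close>

text \<open>\<open>F_op\<close> is a quotient, so the Bernstein-type estimate needs more than
  moments: its denominator must stay away from zero uniformly in n and along the whole segment from
  x to y. One lattice point within distance 1 of n x in every coordinate is enough, because \<phi>
  is bounded below on [-1, 1]. Near the boundary of the box such a point is certain once every side
  has n (b_i - a_i) \<ge> 1, which is one reason why only large n are considered. Positivity of the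
  lower bound for \<phi> rests on the concavity of \<sigma>.

  The derivative of the denominator contributes a second term of the same order; this is the origin
  of the squared ratio in the constant. First moments suffice because f(k/n) - f(p) is at most
  \<omega>(1/n) (1 + |k - n p|).\<close>

lemma modulus_ge:
  assumes I: "compact I" "continuous_on I f" and xy: "x \<in> I" "y \<in> I" "dist x y \<le> \<delta>"
  shows "\<bar>f x - f y\<bar> \<le> modulus f I \<delta>"
proof -
  obtain B where B: "\<And>x. x \<in> I \<Longrightarrow> \<bar>f x\<bar> \<le> B"
    using compact_imp_bounded[OF compact_continuous_image[OF I(2,1)]]
    by (auto simp: bounded_iff)
  \<comment> \<open>A real \<open>SUP\<close> over an unbounded set carries no information, so
    compactness is used to bound f first.\<close>
  have "bdd_above ((\<lambda>p. \<bar>f (fst p) - f (snd p)\<bar>) ` {(x, y). x \<in> I \<and> y \<in> I \<and> dist x y \<le> \<delta>})"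
  proof (rule bdd_aboveI2[where M = "2 * B"])
    fix p assume "p \<in> {(x, y). x \<in> I \<and> y \<in> I \<and> dist x y \<le> \<delta>}"
    then have "\<bar>f (fst p)\<bar> \<le> B" "\<bar>f (snd p)\<bar> \<le> B" using B by auto
    then show "\<bar>f (fst p) - f (snd p)\<bar> \<le> 2 * B" by linarith
  qed
  then show ?thesis
    unfolding modulus_def using xy by (intro cSUP_upper2[of _ _ "(x, y)"]) auto
qed

lemma modulus_le:
  assumes "I \<noteq> {}" "0 \<le> \<delta>"
    and "\<And>x y. x \<in> I \<Longrightarrow> y \<in> I \<Longrightarrow> dist x y \<le> \<delta> \<Longrightarrow> \<bar>f x - f y\<bar> \<le> M"
  shows "modulus f I \<delta> \<le> M"
proof -
  obtain z where "z \<in> I" using assms(1) by blast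
  then have "{(x, y). x \<in> I \<and> y \<in> I \<and> dist x y \<le> \<delta>} \<noteq> {}" using assms(2) by force
  then show ?thesis
    unfolding modulus_def by (rule cSUP_least) (use assms(3) in auto)
qed

lemma modulus_mono:
  assumes "compact I" "continuous_on I f" "I \<noteq> {}" "0 \<le> s" "s \<le> t"
  shows "modulus f I s \<le> modulus f I t"
proof (rule modulus_le[OF assms(3,4)])
  fix x y assume "x \<in> I" "y \<in> I" "dist x y \<le> s"
  then show "\<bar>f x - f y\<bar> \<le> modulus f I t"
    using assms(5) by (intro modulus_ge[OF assms(1,2)]) auto
qed

lemma modulus_nonneg:
  assumes "compact I" "continuous_on I f" "I \<noteq> {}" "0 \<le> \<delta>"
  shows "0 \<le> modulus f I \<delta>"
proof -
  obtain z where "z \<in> I" using assms(3) by blast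
  then show ?thesis using modulus_ge[OF assms(1,2), of z z \<delta>] assms(4) by simp
qed

text \<open>The segment from x to y is cut into m pieces of length at most \<delta>, each costing
  one modulus. Convexity keeps the division points in I, and rounding up gives m \<le> 1 + dist x y
  / \<delta>.\<close>

lemma diff_le_modulus_dilation:
  assumes I: "compact I" "continuous_on I f" "convex I"
    and x: "x \<in> I" and y: "y \<in> I" and \<delta>: "0 < \<delta>"
  shows "\<bar>f x - f y\<bar> \<le> modulus f I \<delta> * (1 + dist x y / \<delta>)"
proof (cases "x = y")
  case True
  then show ?thesis using modulus_nonneg[of I f \<delta>] assms by auto
next
  case False
  define m where "m = nat \<lceil>dist x y / \<delta>\<rceil>"
  have m_ge: "dist x y / \<delta> \<le> real m" unfolding m_def by linarith
  have m_le: "real m \<le> 1 + dist x y / \<delta>"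
    unfolding m_def using divide_nonneg_pos[OF zero_le_dist \<delta>, of x y] by linarith
  have m: "0 < real m" using m_ge divide_pos_pos[OF _ \<delta>, of "dist x y"] False by simp
  define p where "p i = x + (real i / real m) *\<^sub>R (y - x)" for i
  have pI: "p i \<in> I" if "i \<le> m" for i
  proof -
    have "p i = (1 - real i / real m) *\<^sub>R x + (real i / real m) *\<^sub>R y"
      unfolding p_def by (simp add: algebra_simps)
    then show ?thesis using convexD_alt[OF I(3) x y, of "real i / real m"] that m by simp
  qed
  have step: "\<bar>f (p (Suc i)) - f (p i)\<bar> \<le> modulus f I \<delta>" if "i < m" for i
  proof (rule modulus_ge[OF I(1,2)])
    have "p (Suc i) - p i = (1 / real m) *\<^sub>R (y - x)"
      unfolding p_def using m by (simp add: algebra_simps flip: scaleR_diff_left)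
        (simp add: scaleR_left_distrib add_divide_distrib)
    then have "dist (p (Suc i)) (p i) = dist x y / real m"
      by (simp add: dist_norm norm_minus_commute)
    moreover have "dist x y / real m \<le> \<delta>" using m_ge m \<delta> by (simp add: field_simps)
    ultimately show "dist (p (Suc i)) (p i) \<le> \<delta>" by simp
  qed (use that in \<open>auto intro: pI\<close>)
  have "\<bar>f (p i) - f (p 0)\<bar> \<le> real i * modulus f I \<delta>" if "i \<le> m" for i
    using that
  proof (induction i)
    case (Suc i)
    then show ?case using step[of i] by (simp add: algebra_simps)
  qed simp
  from this[of m] have "\<bar>f y - f x\<bar> \<le> real m * modulus f I \<delta>"
    using m by (simp add: p_def)
  also have "\<dots> \<le> (1 + dist x y / \<delta>) * modulus f I \<delta>"
  proof (rule mult_right_mono[OF m_le])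
    show "0 \<le> modulus f I \<delta>" by (rule modulus_nonneg[OF I(1,2)]) (use x \<delta> in auto)
  qed
  finally show ?thesis unfolding abs_minus_commute[of "f y" "f x"] mult.commute[of "1 + _"] .
qed

text \<open>The inequality amounts to 2 B \<le> M powr (1 - \<nu>), whose right side is unbounded in
  M since \<nu> < 1.\<close>

lemma exists_contraction_ratio:
  fixes B \<nu> :: real
  assumes "0 \<le> B" "\<nu> < 1"
  shows "\<exists>M::nat. 2 \<le> M \<and> B / real M \<le> real M powr (-\<nu>) / 2"
proof -
  define M where "M = nat \<lceil>(2 * B) powr (1 / (1 - \<nu>))\<rceil> + 2"
  have "(2 * B) powr (1 / (1 - \<nu>)) \<le> real M" unfolding M_def by linarith
  then have "((2 * B) powr (1 / (1 - \<nu>))) powr (1 - \<nu>) \<le> real M powr (1 - \<nu>)"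
    using assms by (intro powr_mono2) auto
  then have "2 * B \<le> real M powr (1 - \<nu>)" using assms by (simp add: powr_powr)
  also have "\<dots> = real M * real M powr (-\<nu>)"
    using powr_mult_base[of "real M" "-\<nu>"] by simp
  finally have "B / real M \<le> real M powr (-\<nu>) / 2"
    if "0 < real M" using that by (simp add: field_simps)
  moreover have "0 < real M" unfolding M_def by linarith
  ultimately show ?thesis by (intro exI[of _ M]) (auto simp: M_def)
qed

text \<open>The Berens--Lorentz argument: along \<open>n = n0 * M ^ j\<close> with \<open>B / M \<le> M powr (-\<nu>) / 2\<close>
  the recursion becomes a contraction for \<open>\<omega> (1 / n) * n powr \<nu>\<close>; this is where \<open>\<nu> < 1\<close> enters.\<close>

lemma berens_lorentz:
  fixes \<omega> :: "real \<Rightarrow> real"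
  assumes mono: "\<And>s t. 0 < s \<Longrightarrow> s \<le> t \<Longrightarrow> \<omega> s \<le> \<omega> t"
    and nu: "0 < \<nu>" "\<nu> < 1" and B: "0 \<le> B" and C: "0 \<le> C" and n0: "1 \<le> (n0::nat)"
    and rec: "\<And>n \<delta>. n0 \<le> n \<Longrightarrow> 0 < \<delta> \<Longrightarrow>
      \<omega> \<delta> \<le> C * real n powr (-\<nu>) + B * real n * \<delta> * \<omega> (1 / real n)"
  shows "\<exists>K. \<forall>\<delta>. 0 < \<delta> \<and> \<delta> \<le> 1 / real n0 \<longrightarrow> \<omega> \<delta> \<le> K * \<delta> powr \<nu>"
proof -
  obtain M :: nat where M: "2 \<le> M" "B / real M \<le> real M powr (-\<nu>) / 2"
    using exists_contraction_ratio[OF B nu(2)] by blast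
  define N where "N j = n0 * M ^ j" for j
  have N0: "n0 \<le> N j" for j unfolding N_def using M(1) by simp
  then have Npos: "0 < real (N j)" for j using n0 by (meson less_le_trans of_nat_0_less_iff zero_less_one)
  have NSuc: "real (N (Suc j)) = real M * real (N j)" for j by (simp add: N_def)
  \<comment> \<open>The second entry starts the induction. The first makes the error term C * P at
    most half of the next bound; the contraction supplies the other half.\<close>
  define K where "K = max (2 * C * real M powr \<nu>) (\<omega> (1 / real n0) * real n0 powr \<nu>)"
  have K0: "0 \<le> K" unfolding K_def using C by (simp add: le_max_iff_disj)
  have claim: "\<omega> (1 / real (N j)) \<le> K * real (N j) powr (-\<nu>)" for j
  proof (induction j)
    case 0
    have "\<omega> (1 / real n0) = (\<omega> (1 / real n0) * real n0 powr \<nu>) * real n0 powr (-\<nu>)"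
      using n0 by (simp add: powr_minus)
    also have "\<dots> \<le> K * real n0 powr (-\<nu>)" unfolding K_def by (intro mult_right_mono) auto
    finally show ?case by (simp add: N_def)
  next
    case (Suc j)
    define P where "P = real (N j) powr (-\<nu>)"
    have P: "0 \<le> P" by (simp add: P_def)
    have MP: "real (N (Suc j)) powr (-\<nu>) = real M powr (-\<nu>) * P"
      unfolding P_def NSuc by (simp add: powr_mult)
    have M1: "real M powr \<nu> * real M powr (-\<nu>) = 1" using M(1) by (simp add: powr_minus)
    \<comment> \<open>The recursion is applied with n = \<open>N j\<close> and \<delta> = 1 /
      \<open>N (Suc j)\<close>, so that n \<delta> = 1 / M.\<close>
    have "\<omega> (1 / real (N (Suc j)))
        \<le> C * P + B * real (N j) * (1 / real (N (Suc j))) * \<omega> (1 / real (N j))"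
      unfolding P_def by (rule rec) (use N0 Npos in auto)
    also have "B * real (N j) * (1 / real (N (Suc j))) = B / real M"
      using Npos[of j] unfolding NSuc by simp
    also have "C * P + B / real M * \<omega> (1 / real (N j))
        \<le> C * P + (real M powr (-\<nu>) / 2) * (K * P)"
    proof -
      have "B / real M * \<omega> (1 / real (N j)) \<le> B / real M * (K * P)"
        using Suc B unfolding P_def by (intro mult_left_mono) auto
      also have "\<dots> \<le> (real M powr (-\<nu>) / 2) * (K * P)"
        using M(2) K0 P by (intro mult_right_mono) auto
      finally show ?thesis by simp
    qed
    also have "C * P = (2 * C * real M powr \<nu>) * (real M powr (-\<nu>) * P) / 2"
      using M1 by (simp add: mult_ac)
    also have "\<dots> \<le> K * (real M powr (-\<nu>) * P) / 2"
      unfolding K_def using P by (intro divide_right_mono mult_right_mono) auto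
    finally show ?case unfolding MP by (simp add: algebra_simps)
  qed
  have "\<omega> \<delta> \<le> (K * real M powr \<nu>) * \<delta> powr \<nu>" if \<delta>: "0 < \<delta>" "\<delta> \<le> 1 / real n0" for \<delta>
  proof -
    \<comment> \<open>The least crossing of Q places \<delta> between the neighbouring scales 1 /
      \<open>N (Suc j)\<close> and 1 / \<open>N j\<close>; monotonicity then costs only the factor M
      powr \<nu>.\<close>
    define Q where "Q j \<longleftrightarrow> 1 / \<delta> < real (N j)" for j
    obtain m where m: "1 / \<delta> < real M ^ m" using real_arch_pow[of "real M" "1 / \<delta>"] M(1) by auto
    also have "\<dots> \<le> real (N m)" unfolding N_def using n0 by (simp add: mult_le_cancel_right1)
    finally have "Q m" by (simp add: Q_def)
    moreover have "\<not> Q 0" using \<delta> n0 by (simp add: Q_def N_def field_simps)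
    ultimately obtain j where j: "\<not> Q j" "Q (Suc j)" using ex_least_nat_less[of Q m] by blast
    have "\<delta> \<le> 1 / real (N j)" using j(1) \<delta> Npos[of j] by (simp add: Q_def field_simps)
    then have "\<omega> \<delta> \<le> \<omega> (1 / real (N j))" by (intro mono \<delta>)
    also have "\<dots> \<le> K * real (N j) powr (-\<nu>)" by (rule claim)
    also have "real (N j) powr (-\<nu>) = real M powr \<nu> * (1 / real (N (Suc j))) powr \<nu>"
      unfolding NSuc using M(1) Npos[of j] by (simp add: powr_divide powr_mult powr_minus field_simps)
    also have "K * (real M powr \<nu> * (1 / real (N (Suc j))) powr \<nu>)
        \<le> K * (real M powr \<nu> * \<delta> powr \<nu>)"
    proof -
      have "1 / real (N (Suc j)) \<le> \<delta>" using j(2) \<delta> Npos[of "Suc j"] by (simp add: Q_def field_simps)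
      then show ?thesis using K0 nu by (intro mult_left_mono powr_mono2) auto
    qed
    finally show ?thesis by (simp add: mult_ac)
  qed
  then show ?thesis by blast
qed

section \<open>Moments of the kernel\<close>

text \<open>Replacing u by its floor makes the majorant independent of u, since |k - floor u| \<le>
  1 + |u - k|; it is summable because \<alpha> > 1.\<close>

lemma sum_int_shift_powr_bounded:
  fixes \<alpha> :: real
  assumes "1 < \<alpha>"
  shows "\<exists>A. \<forall>u. \<forall>K::int set. finite K \<longrightarrow> (\<Sum>k\<in>K. (1 + \<bar>u - of_int k\<bar>) powr (-\<alpha>)) \<le> A"
proof -
  \<comment> \<open>The value at 0 is set by hand: \<open>0 powr (-\<alpha>)\<close> is 0, while the
    term with k = floor u can be as large as 1.\<close>
  define h :: "nat \<Rightarrow> real" where "h j = (if j = 0 then 1 else real j powr (-\<alpha>))" for j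
  have h0: "0 \<le> h j" for j by (simp add: h_def)
  have sm: "summable h"
  proof (rule summable_comparison_test_ev)
    show "\<forall>\<^sub>F n in sequentially. norm (h n) \<le> real n powr (-\<alpha>)"
      using eventually_gt_at_top[of 0] by eventually_elim (simp add: h_def)
    show "summable (\<lambda>n. real n powr (-\<alpha>))" using assms by (subst summable_real_powr_iff) simp
  qed
  have one: "(\<Sum>m\<in>L. h (nat \<bar>m\<bar>)) \<le> suminf h" if "finite L" "inj_on (\<lambda>m. nat \<bar>m\<bar>) L" for L :: "int set"
  proof -
    have "(\<Sum>m\<in>L. h (nat \<bar>m\<bar>)) = sum h ((\<lambda>m. nat \<bar>m\<bar>) ` L)" using that by (simp add: sum.reindex)
    also have "\<dots> \<le> suminf h" using sm that h0 by (intro sum_le_suminf) auto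
    finally show ?thesis .
  qed
  have "(\<Sum>k\<in>K. (1 + \<bar>u - of_int k\<bar>) powr (-\<alpha>)) \<le> 2 * suminf h" if K: "finite K" for u :: real and K :: "int set"
  proof -
    define L where "L = (\<lambda>k. k - \<lfloor>u\<rfloor>) ` K"
    have finL: "finite L" using K by (simp add: L_def)
    have "(\<Sum>k\<in>K. (1 + \<bar>u - of_int k\<bar>) powr (-\<alpha>)) \<le> (\<Sum>k\<in>K. h (nat \<bar>k - \<lfloor>u\<rfloor>\<bar>))"
    proof (rule sum_mono)
      fix k
      show "(1 + \<bar>u - of_int k\<bar>) powr (-\<alpha>) \<le> h (nat \<bar>k - \<lfloor>u\<rfloor>\<bar>)"
      proof (cases "k = \<lfloor>u\<rfloor>")
        case True
        have "(1 + \<bar>u - of_int k\<bar>) powr (-\<alpha>) \<le> 1 powr (-\<alpha>)"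
          using assms by (intro powr_mono2') auto
        then show ?thesis using True by (simp add: h_def)
      next
        case False
        have "real (nat \<bar>k - \<lfloor>u\<rfloor>\<bar>) = \<bar>of_int k - of_int \<lfloor>u\<rfloor>\<bar>" by simp
        also have "\<dots> \<le> 1 + \<bar>u - of_int k\<bar>" by linarith
        finally have "(1 + \<bar>u - of_int k\<bar>) powr (-\<alpha>) \<le> real (nat \<bar>k - \<lfloor>u\<rfloor>\<bar>) powr (-\<alpha>)"
          using assms False by (intro powr_mono2') auto
        then show ?thesis using False by (simp add: h_def)
      qed
    qed
    also have "\<dots> = (\<Sum>m\<in>L. h (nat \<bar>m\<bar>))" unfolding L_def by (subst sum.reindex) (auto simp: inj_on_def)
    \<comment> \<open>The absolute value is injective only on each half-line, hence the split and
      the factor 2.\<close>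
    also have "\<dots> = (\<Sum>m\<in>L \<inter> {0..}. h (nat \<bar>m\<bar>)) + (\<Sum>m\<in>L - {0..}. h (nat \<bar>m\<bar>))"
      by (rule sum.Int_Diff[OF finL])
    also have "\<dots> \<le> suminf h + suminf h"
      using finL by (intro add_mono one) (auto simp: inj_on_def)
    finally show ?thesis by simp
  qed
  then show ?thesis by blast
qed

section \<open>Positivity, lower bound and decay of the kernel\<close>

lemma sigmoidal_nonneg:
  assumes "sigmoidal \<sigma>"
  shows "0 \<le> \<sigma> x"
proof (rule tendsto_upperbound)
  show "(\<sigma> \<longlongrightarrow> 0) at_bot" using assms by (simp add: sigmoidal_def)
  show "\<forall>\<^sub>F y in at_bot. \<sigma> y \<le> \<sigma> x"
    using assms by (intro eventually_mono[OF eventually_le_at_bot[of x]]) (simp add: sigmoidal_def monoD)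
qed simp

lemma sigmoidal_le_one:
  assumes "sigmoidal \<sigma>"
  shows "\<sigma> x \<le> 1"
proof (rule tendsto_lowerbound)
  show "(\<sigma> \<longlongrightarrow> 1) at_top" using assms by (simp add: sigmoidal_def)
  show "\<forall>\<^sub>F y in at_top. \<sigma> x \<le> \<sigma> y"
    using assms by (intro eventually_mono[OF eventually_ge_at_top[of x]]) (simp add: sigmoidal_def monoD)
qed simp

lemma phi_sigma_nonneg:
  assumes "sigmoidal \<sigma>"
  shows "0 \<le> phi_sigma \<sigma> x"
proof -
  have "\<sigma> (x - 1) \<le> \<sigma> (x + 1)" using assms by (intro monoD[of \<sigma>]) (simp_all add: sigmoidal_def)
  then show ?thesis by (simp add: phi_sigma_def)
qed

lemma phi_sigma_le:
  assumes "sigmoidal \<sigma>"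
  shows "phi_sigma \<sigma> x \<le> \<sigma> (x + 1)"
  using sigmoidal_nonneg[OF assms, of "x - 1"] sigmoidal_nonneg[OF assms, of "x + 1"]
  unfolding phi_sigma_def by (simp add: field_simps)

lemma phi_sigma_even:
  assumes "sigma_conditions \<sigma> \<alpha>"
  shows "phi_sigma \<sigma> (-x) = phi_sigma \<sigma> x"
proof -
  have odd: "\<sigma> (-y) = 1 - \<sigma> y" for y
    using assms unfolding sigma_conditions_def by (auto dest!: spec[of _ y])
  have "-x + 1 = - (x - 1)" "-x - 1 = - (x + 1)" by simp_all
  then show ?thesis unfolding phi_sigma_def by (simp only: odd) simp
qed

lemma sigma_zero:
  assumes "sigma_conditions \<sigma> \<alpha>"
  shows "\<sigma> 0 = 1 / 2"
proof -
  have "\<sigma> (-0) - 1/2 = - (\<sigma> 0 - 1/2)" using assms unfolding sigma_conditions_def by blast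
  then show ?thesis by simp
qed

text \<open>If \<sigma> 1 \<le> 1/2 = \<sigma> 0, concavity on the chord from 0 to t, evaluated at
  1, forces \<sigma> t \<le> 1/2 for all t \<ge> 1, against the limit 1.\<close>

lemma sigma_one_gt_half:
  assumes "sigma_conditions \<sigma> \<alpha>"
  shows "1 / 2 < \<sigma> 1"
proof (rule ccontr)
  assume neg: "\<not> 1 / 2 < \<sigma> 1"
  have conc: "concave_on {0..} \<sigma>" and lim: "(\<sigma> \<longlongrightarrow> 1) at_top"
    using assms by (auto simp: sigma_conditions_def sigmoidal_def)
  have "\<sigma> t \<le> 1 / 2" if t: "1 \<le> t" for t
  proof -
    have "(1 - 1 / t) * \<sigma> 0 + (1 / t) * \<sigma> t \<le> \<sigma> ((1 - 1 / t) *\<^sub>R 0 + (1 / t) *\<^sub>R t)"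
      using t by (intro concave_onD[OF conc]) auto
    then have "(1 - 1 / t) * (1 / 2) + (1 / t) * \<sigma> t \<le> \<sigma> 1"
      using t sigma_zero[OF assms] by simp
    then have "(1 / t) * \<sigma> t \<le> (1 / t) * (1 / 2)"
      using neg unfolding left_diff_distrib by linarith
    then show ?thesis using t mult_le_cancel_left_pos[of "1 / t" "\<sigma> t" "1 / 2"] by simp
  qed
  then have "\<forall>\<^sub>F t in at_top. \<sigma> t \<le> 1 / 2"
    by (rule eventually_mono[OF eventually_ge_at_top])
  with lim have "(1::real) \<le> 1 / 2" by (intro tendsto_upperbound[of \<sigma> 1 at_top]) auto
  then show False by simp
qed

text \<open>For 0 \<le> x \<le> 1 monotonicity gives \<sigma> (x + 1) \<ge> \<sigma> 1 and \<sigma>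
  (x - 1) \<le> \<sigma> 0 = 1/2; evenness covers negative x. This bound keeps the denominator of
  \<open>F_op\<close> away from zero.\<close>

lemma phi_sigma_ge:
  assumes "sigma_conditions \<sigma> \<alpha>" and "\<bar>x\<bar> \<le> 1"
  shows "(\<sigma> 1 - 1 / 2) / 2 \<le> phi_sigma \<sigma> x"
proof -
  have m: "mono \<sigma>" using assms by (auto simp: sigma_conditions_def sigmoidal_def)
  have pos: "(\<sigma> 1 - 1 / 2) / 2 \<le> phi_sigma \<sigma> y" if "0 \<le> y" "y \<le> 1" for y
    using monoD[OF m, of 1 "y + 1"] monoD[OF m, of "y - 1" 0] sigma_zero[OF assms(1)] that
    unfolding phi_sigma_def by simp
  show ?thesis
  proof (cases "0 \<le> x")
    case True
    then show ?thesis using pos assms(2) by simp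
  next
    case False
    then show ?thesis using pos[of "-x"] assms(2) by (simp add: phi_sigma_even[OF assms(1)])
  qed
qed

text \<open>Decay of \<sigma> is known only at minus infinity; evenness of the kernel transfers it
  to plus infinity.\<close>

lemma phi_sigma_decay:
  assumes "sigma_conditions \<sigma> \<alpha>"
  shows "\<exists>C. \<forall>x. phi_sigma \<sigma> x \<le> C * (1 + \<bar>x\<bar>) powr (-1 - \<alpha>)"
proof -
  have sg: "sigmoidal \<sigma>" and al: "0 < \<alpha>" and big: "\<sigma> \<in> O[at_bot](\<lambda>x. \<bar>x\<bar> powr (-1 - \<alpha>))"
    using assms by (auto simp: sigma_conditions_def)
  obtain c where c: "0 < c" "\<forall>\<^sub>F x in at_bot. norm (\<sigma> x) \<le> c * norm (\<bar>x\<bar> powr (-1 - \<alpha>))"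
    using landau_o.bigE[OF big] by blast
  obtain X where X: "\<And>x. x \<le> X \<Longrightarrow> norm (\<sigma> x) \<le> c * norm (\<bar>x\<bar> powr (-1 - \<alpha>))"
    using c(2) unfolding eventually_at_bot_linorder by blast
  \<comment> \<open>For |x| \<ge> R, the entry 1 - X puts 1 - |x| into the range where the bound on
    \<sigma> holds, and the entry 2 gives |x| - 1 \<ge> (1 + |x|) / 3.\<close>
  define R where "R = max 2 (1 - X)"
  define C where "C = max (c * 3 powr (1 + \<alpha>)) ((1 + R) powr (1 + \<alpha>))"
  have "phi_sigma \<sigma> x \<le> C * (1 + \<bar>x\<bar>) powr (-1 - \<alpha>)" for x
  proof (cases "R \<le> \<bar>x\<bar>")
    case True
    define y where "y = - \<bar>x\<bar>"
    have y: "y + 1 \<le> X" "y \<le> -2" using True by (auto simp: y_def R_def)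
    have "phi_sigma \<sigma> x = phi_sigma \<sigma> y"
      unfolding y_def by (cases "0 \<le> x") (simp_all add: phi_sigma_even[OF assms])
    also have "\<dots> \<le> c * \<bar>y + 1\<bar> powr (-1 - \<alpha>)"
      using phi_sigma_le[OF sg, of y] X[OF y(1)] sigmoidal_nonneg[OF sg, of "y + 1"] by simp
    also have "\<dots> \<le> c * ((1 + \<bar>x\<bar>) / 3) powr (-1 - \<alpha>)"
      using y al c(1) by (intro mult_left_mono powr_mono2') (auto simp: y_def)
    also have "((1 + \<bar>x\<bar>) / 3) powr (-1 - \<alpha>) = 3 powr (1 + \<alpha>) * (1 + \<bar>x\<bar>) powr (-1 - \<alpha>)"
    proof -
      have "(3::real) powr (-1 - \<alpha>) = inverse (3 powr (1 + \<alpha>))"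
        using powr_minus[of "3::real" "1 + \<alpha>"] by simp
      then show ?thesis by (simp add: powr_divide field_simps)
    qed
    also have "c * (3 powr (1 + \<alpha>) * (1 + \<bar>x\<bar>) powr (-1 - \<alpha>)) \<le> C * (1 + \<bar>x\<bar>) powr (-1 - \<alpha>)"
      unfolding C_def mult.assoc[symmetric] by (intro mult_right_mono) auto
    finally show ?thesis .
  next
    case False
    have "phi_sigma \<sigma> x \<le> 1" using phi_sigma_le[OF sg, of x] sigmoidal_le_one[OF sg, of "x + 1"] by simp
    also have "1 = (1 + \<bar>x\<bar>) powr (1 + \<alpha>) * (1 + \<bar>x\<bar>) powr (-1 - \<alpha>)"
      by (simp flip: powr_add)
    also have "\<dots> \<le> C * (1 + \<bar>x\<bar>) powr (-1 - \<alpha>)"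
    proof (rule mult_right_mono)
      have "(1 + \<bar>x\<bar>) powr (1 + \<alpha>) \<le> (1 + R) powr (1 + \<alpha>)"
        using False al by (intro powr_mono2) auto
      then show "(1 + \<bar>x\<bar>) powr (1 + \<alpha>) \<le> C" by (simp add: C_def)
    qed simp
    finally show ?thesis .
  qed
  then show ?thesis by blast
qed

text \<open>The weight uses up one power of the decay, and the remaining exponent -\<alpha> is
  summable because \<alpha> > 1.\<close>

lemma phi_sigma_weighted_sum_bounded:
  assumes "sigma_conditions \<sigma> \<alpha>" and "1 < \<alpha>"
  shows "\<exists>A. \<forall>u. \<forall>K::int set. finite K \<longrightarrow>
    (\<Sum>k\<in>K. (1 + \<bar>u - of_int k\<bar>) * phi_sigma \<sigma> (u - of_int k)) \<le> A"
proof -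
  obtain C where C: "\<And>x. phi_sigma \<sigma> x \<le> C * (1 + \<bar>x\<bar>) powr (-1 - \<alpha>)"
    using phi_sigma_decay[OF assms(1)] by blast
  have "0 \<le> C"
    using C[of 0] phi_sigma_nonneg[of \<sigma> 0] assms(1) by (simp add: sigma_conditions_def)
  obtain A where A: "\<And>u (K::int set). finite K \<Longrightarrow> (\<Sum>k\<in>K. (1 + \<bar>u - of_int k\<bar>) powr (-\<alpha>)) \<le> A"
    using sum_int_shift_powr_bounded[OF assms(2)] by blast
  have pt: "(1 + \<bar>x\<bar>) * phi_sigma \<sigma> x \<le> C * (1 + \<bar>x\<bar>) powr (-\<alpha>)" for x
  proof -
    have "(1 + \<bar>x\<bar>) * phi_sigma \<sigma> x \<le> (1 + \<bar>x\<bar>) * (C * (1 + \<bar>x\<bar>) powr (-1 - \<alpha>))"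
      using C[of x] by (intro mult_left_mono) auto
    also have "\<dots> = C * ((1 + \<bar>x\<bar>) * (1 + \<bar>x\<bar>) powr (-1 - \<alpha>))" by simp
    also have "(1 + \<bar>x\<bar>) * (1 + \<bar>x\<bar>) powr (-1 - \<alpha>) = (1 + \<bar>x\<bar>) powr (-\<alpha>)"
      by (simp add: powr_mult_base)
    finally show ?thesis .
  qed
  have "(\<Sum>k\<in>K. (1 + \<bar>u - of_int k\<bar>) * phi_sigma \<sigma> (u - of_int k)) \<le> C * A"
    if "finite K" for u and K :: "int set"
  proof -
    have "(\<Sum>k\<in>K. (1 + \<bar>u - of_int k\<bar>) * phi_sigma \<sigma> (u - of_int k))
        \<le> (\<Sum>k\<in>K. C * (1 + \<bar>u - of_int k\<bar>) powr (-\<alpha>))"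
      by (intro sum_mono pt)
    also have "\<dots> \<le> C * A"
      unfolding sum_distrib_left[symmetric] using A[OF that] \<open>0 \<le> C\<close> by (intro mult_left_mono) auto
    finally show ?thesis .
  qed
  then show ?thesis by blast
qed

lemma phi_sigma_has_derivative:
  assumes "sigma_conditions \<sigma> \<alpha>"
  shows "(phi_sigma \<sigma> has_real_derivative (deriv \<sigma> (x + 1) - deriv \<sigma> (x - 1)) / 2) (at x)"
proof -
  have d: "(\<sigma> has_real_derivative deriv \<sigma> y) (at y)" for y
    using assms by (simp add: sigma_conditions_def DERIV_deriv_iff_real_differentiable)
  have "((\<lambda>x. (\<sigma> (x + 1) - \<sigma> (x - 1)) / 2) has_real_derivative
      (deriv \<sigma> (x + 1) * (1 + 0) - deriv \<sigma> (x - 1) * (1 - 0)) / 2) (at x)"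
    by (intro DERIV_cdivide DERIV_diff DERIV_chain2[where f = \<sigma>] d DERIV_add DERIV_ident DERIV_const)
  moreover have "phi_sigma \<sigma> = (\<lambda>x. (\<sigma> (x + 1) - \<sigma> (x - 1)) / 2)"
    by (simp add: phi_sigma_def fun_eq_iff)
  ultimately show ?thesis by simp
qed

text \<open>Needed to bound the derivative near 0, where the factor |k - x| in the first moment
  degenerates.\<close>

lemma continuous_on_deriv_phi_sigma:
  assumes "sigma_conditions \<sigma> \<alpha>"
  shows "continuous_on S (deriv (phi_sigma \<sigma>))"
proof -
  have eq: "deriv (phi_sigma \<sigma>) = (\<lambda>x. (deriv \<sigma> (x + 1) - deriv \<sigma> (x - 1)) / 2)"
    using DERIV_imp_deriv[OF phi_sigma_has_derivative[OF assms]] by (simp add: fun_eq_iff)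
  have "continuous_on UNIV (deriv \<sigma>)"
    using assms unfolding sigma_conditions_def continuous_on_eq_continuous_at[OF open_UNIV]
    by (blast intro: differentiable_imp_continuous_within)
  then have "continuous_on S (\<lambda>x. deriv \<sigma> (x + 1))" "continuous_on S (\<lambda>x. deriv \<sigma> (x - 1))"
    by (auto intro!: continuous_on_compose2[of UNIV "deriv \<sigma>"] continuous_intros)
  then show ?thesis
    unfolding eq by (intro continuous_on_divide continuous_on_diff continuous_on_const) auto
qed

text \<open>A nonnegative infinite sum in \<open>ennreal\<close> is the supremum of its finite
  subsums; finiteness of the moment lets it be read as a real bound uniform in u.\<close>

lemma M_moment_finite_imp_sum_le:
  assumes "M_moment 1 g < top"
  shows "\<exists>A\<ge>0. \<forall>u. \<forall>K::int set. finite K \<longrightarrow> (\<Sum>k\<in>K. \<bar>g (u - of_int k)\<bar> * \<bar>u - of_int k\<bar>) \<le> A"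
proof -
  define t where "t u k = \<bar>g (u - of_int k)\<bar> * \<bar>u - of_int k\<bar>" for u and k :: int
  have "(\<Sum>k\<in>K. t u k) \<le> enn2real (M_moment 1 g)" if K: "finite K" for u and K :: "int set"
  proof -
    have "ennreal (\<Sum>k\<in>K. t u k) = (\<Sum>k\<in>K. ennreal (t u k))"
      by (rule sum_ennreal[symmetric]) (simp add: t_def)
    also have "\<dots> \<le> (SUP F\<in>{F. finite F \<and> F \<subseteq> UNIV}. \<Sum>k\<in>F. ennreal (t u k))"
      using K by (intro SUP_upper) auto
    also have "\<dots> = (\<Sum>\<^sub>\<infinity>k. ennreal (t u k))" by (rule nonneg_infsum_complete[symmetric]) simp
    also have "\<dots> \<le> M_moment 1 g"
      unfolding M_moment_def t_def by (rule SUP_upper2[of u]) (auto simp: abs_minus_commute)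
    also have "\<dots> = ennreal (enn2real (M_moment 1 g))" using assms by simp
    finally show ?thesis by (simp add: ennreal_le_iff)
  qed
  then show ?thesis unfolding t_def by (intro exI[of _ "enn2real (M_moment 1 g)"]) auto
qed

text \<open>Where |u - k| > 1 the weight is at most 2 |u - k|, which the moment controls. At most
  three k remain, and there g is bounded by continuity.\<close>

lemma weighted_sum_bounded_if_M_moment:
  assumes M: "M_moment 1 g < top" and cont: "continuous_on {-1..1} g"
  shows "\<exists>A. \<forall>u. \<forall>K::int set. finite K \<longrightarrow>
    (\<Sum>k\<in>K. (1 + \<bar>u - of_int k\<bar>) * \<bar>g (u - of_int k)\<bar>) \<le> A"
proof -
  obtain A where A0: "0 \<le> A" and
    A: "\<And>u (K::int set). finite K \<Longrightarrow> (\<Sum>k\<in>K. \<bar>g (u - of_int k)\<bar> * \<bar>u - of_int k\<bar>) \<le> A"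
    using M_moment_finite_imp_sum_le[OF M] by blast
  have "bounded (g ` {-1..1})" using compact_imp_bounded[OF compact_continuous_image[OF cont]] by simp
  then obtain B where "\<forall>x\<in>{-1..1}. \<bar>g x\<bar> \<le> B" by (auto simp: bounded_iff)
  then have B: "\<And>x. \<bar>x\<bar> \<le> 1 \<Longrightarrow> \<bar>g x\<bar> \<le> B" by (auto simp: abs_le_iff)
  have B0: "0 \<le> B" using B[of 0] by simp
  have "(\<Sum>k\<in>K. (1 + \<bar>u - of_int k\<bar>) * \<bar>g (u - of_int k)\<bar>) \<le> 2 * A + 3 * B"
    if K: "finite K" for u and K :: "int set"
  proof -
    have "(\<Sum>k\<in>K. (1 + \<bar>u - of_int k\<bar>) * \<bar>g (u - of_int k)\<bar>)
        \<le> (\<Sum>k\<in>K. 2 * (\<bar>g (u - of_int k)\<bar> * \<bar>u - of_int k\<bar>)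
             + (if k \<in> {\<lfloor>u\<rfloor> - 1..\<lfloor>u\<rfloor> + 1} then B else 0))"
    proof (rule sum_mono)
      fix k
      show "(1 + \<bar>u - of_int k\<bar>) * \<bar>g (u - of_int k)\<bar>
        \<le> 2 * (\<bar>g (u - of_int k)\<bar> * \<bar>u - of_int k\<bar>)
             + (if k \<in> {\<lfloor>u\<rfloor> - 1..\<lfloor>u\<rfloor> + 1} then B else 0)"
      proof (cases "\<bar>u - of_int k\<bar> \<le> 1")
        case True
        then have "k \<in> {\<lfloor>u\<rfloor> - 1..\<lfloor>u\<rfloor> + 1}" by (simp add: abs_le_iff) linarith
        then show ?thesis using B[OF True] by (simp add: algebra_simps add_increasing2)
      next
        case False
        then have "1 * \<bar>g (u - of_int k)\<bar> \<le> \<bar>u - of_int k\<bar> * \<bar>g (u - of_int k)\<bar>"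
          by (intro mult_right_mono) auto
        then show ?thesis using B0 by (simp add: algebra_simps)
      qed
    qed
    also have "\<dots> = 2 * (\<Sum>k\<in>K. \<bar>g (u - of_int k)\<bar> * \<bar>u - of_int k\<bar>)
        + (\<Sum>k\<in>K \<inter> {\<lfloor>u\<rfloor> - 1..\<lfloor>u\<rfloor> + 1}. B)"
      using K by (simp only: sum.distrib sum_distrib_left sum.inter_restrict)
    also have "(\<Sum>k\<in>K \<inter> {\<lfloor>u\<rfloor> - 1..\<lfloor>u\<rfloor> + 1}. B) \<le> (\<Sum>k\<in>{\<lfloor>u\<rfloor> - 1..\<lfloor>u\<rfloor> + 1}. B)"
      using B0 by (intro sum_mono2) auto
    also have "\<dots> = 3 * B" by simp
    finally show ?thesis using A[OF K, of u] by simp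
  qed
  then show ?thesis by blast
qed

section \<open>The Bernstein-type estimate\<close>

definition grid :: "real^'d \<Rightarrow> real^'d \<Rightarrow> nat \<Rightarrow> 'd \<Rightarrow> real set" where
  "grid a b n i = real_of_int ` {\<lceil>real n * a $ i\<rceil>..\<lfloor>real n * b $ i\<rfloor>}"

lemma J_set_eq: "J_set a b n = {k. \<forall>i. k $ i \<in> grid a b n i}"
proof -
  have "grid a b n i = {r \<in> \<int>. of_int \<lceil>real n * a $ i\<rceil> \<le> r \<and> r \<le> of_int \<lfloor>real n * b $ i\<rfloor>}" for i
    unfolding grid_def Ints_def by (auto simp only: atLeastAtMost_iff of_int_le_iff image_iff)
  then show ?thesis by (simp add: J_set_def)
qed

text \<open>The distributive law for functions, carried over to vectors by the bijection
  \<open>vec_nth\<close> / \<open>vec_lambda\<close>.\<close>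

lemma sum_prod_vec:
  fixes g :: "'d::finite \<Rightarrow> 'a \<Rightarrow> real"
  assumes "\<And>i. finite (K i)"
  shows "(\<Sum>k\<in>{k::'a^'d. \<forall>i. k $ i \<in> K i}. \<Prod>i\<in>UNIV. g i (k $ i)) = (\<Prod>i\<in>UNIV. \<Sum>r\<in>K i. g i r)"
proof -
  have "(\<Prod>i\<in>UNIV. \<Sum>r\<in>K i. g i r) = (\<Sum>p\<in>Pi\<^sub>E UNIV K. \<Prod>i\<in>UNIV. g i (p i))"
    by (rule prod_sum_PiE) (use assms in auto)
  also have "\<dots> = (\<Sum>k\<in>{k::'a^'d. \<forall>i. k $ i \<in> K i}. \<Prod>i\<in>UNIV. g i (k $ i))"
    by (rule sum.reindex_bij_witness[of _ vec_nth vec_lambda]) auto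
  finally show ?thesis by simp
qed

lemma finite_J_set: "finite (J_set a b n)"
proof -
  have "J_set a b n \<subseteq> vec_lambda ` Pi\<^sub>E UNIV (grid a b n)"
  proof
    fix k assume "k \<in> J_set a b n"
    then have "vec_nth k \<in> Pi\<^sub>E UNIV (grid a b n)" by (auto simp: J_set_eq)
    moreover have "k = vec_lambda (vec_nth k)" by simp
    ultimately show "k \<in> vec_lambda ` Pi\<^sub>E UNIV (grid a b n)" by blast
  qed
  moreover have "finite (Pi\<^sub>E UNIV (grid a b n))" by (rule finite_PiE) (auto simp: grid_def)
  ultimately show ?thesis using finite_subset finite_imageI by blast
qed

lemma J_set_scaled_in_cbox:
  assumes "k \<in> J_set a b n" and n: "1 \<le> n"
  shows "(1 / real n) *\<^sub>R k \<in> cbox a b"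
proof -
  have "a $ i \<le> k $ i / real n" "k $ i / real n \<le> b $ i" for i
  proof -
    have "real n * a $ i \<le> k $ i" "k $ i \<le> real n * b $ i"
      using assms(1) unfolding J_set_def by (auto dest!: spec[of _ i]) linarith+
    then show "a $ i \<le> k $ i / real n" "k $ i / real n \<le> b $ i" using n by (auto simp: field_simps)
  qed
  then show ?thesis by (simp add: mem_box_cart)
qed

text \<open>In each coordinate the floor of n x_i is taken if it is admissible, and otherwise the
  left end of the index range. The width condition ensures that this left end does not exceed the
  right one.\<close>

lemma J_set_near:
  assumes x: "x \<in> cbox a b" and wide: "\<And>i. 1 \<le> real n * (b $ i - a $ i)"
  obtains k where "k \<in> J_set a b n" "\<And>i. \<bar>(real n *\<^sub>R x - k) $ i\<bar> \<le> 1"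
proof -
  have "\<exists>m::int. \<lceil>real n * a $ i\<rceil> \<le> m \<and> m \<le> \<lfloor>real n * b $ i\<rfloor> \<and> \<bar>real n * x $ i - of_int m\<bar> \<le> 1" for i
  proof -
    have "a $ i \<le> x $ i" "x $ i \<le> b $ i" using x by (auto simp: mem_box_cart)
    then have ax: "real n * a $ i \<le> real n * x $ i" and xb: "real n * x $ i \<le> real n * b $ i"
      by (auto intro: mult_left_mono)
    have w: "real n * a $ i + 1 \<le> real n * b $ i" using wide[of i] by (simp add: algebra_simps)
    show ?thesis
    proof (cases "\<lceil>real n * a $ i\<rceil> \<le> \<lfloor>real n * x $ i\<rfloor>")
      case True
      have "\<lfloor>real n * x $ i\<rfloor> \<le> \<lfloor>real n * b $ i\<rfloor>" by (rule floor_mono[OF xb])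
      moreover have "\<bar>real n * x $ i - of_int \<lfloor>real n * x $ i\<rfloor>\<bar> \<le> 1" by linarith
      ultimately show ?thesis using True by blast
    next
      case False
      have "\<lceil>real n * a $ i\<rceil> \<le> \<lfloor>real n * b $ i\<rfloor>" using w by linarith
      moreover have "\<bar>real n * x $ i - of_int \<lceil>real n * a $ i\<rceil>\<bar> \<le> 1" using ax False by linarith
      ultimately show ?thesis by blast
    qed
  qed
  then obtain m :: "'a \<Rightarrow> int" where m: "\<And>i. \<lceil>real n * a $ i\<rceil> \<le> m i" "\<And>i. m i \<le> \<lfloor>real n * b $ i\<rfloor>"
    "\<And>i. \<bar>real n * x $ i - of_int (m i)\<bar> \<le> 1" by metis
  show ?thesis
    by (rule that[of "\<chi> i. of_int (m i)"]) (use m in \<open>auto simp: J_set_def\<close>)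
qed

text \<open>Exactly what the Bernstein-type estimate uses of \<sigma>. The moments appear as uniform
  bounds on finite subsums, because \<open>J_set\<close> is finite and no series is ever
  needed.\<close>

locale kernel =
  fixes \<sigma> :: "real \<Rightarrow> real" and c A :: real
  assumes phi_deriv: "\<And>x. (phi_sigma \<sigma> has_real_derivative deriv (phi_sigma \<sigma>) x) (at x)"
    and phi_nonneg: "\<And>x. 0 \<le> phi_sigma \<sigma> x"
    and c_pos: "0 < c"
    and phi_ge: "\<And>x. \<bar>x\<bar> \<le> 1 \<Longrightarrow> c \<le> phi_sigma \<sigma> x"
    and phi_sum: "\<And>u (K::int set). finite K \<Longrightarrow>
      (\<Sum>k\<in>K. (1 + \<bar>u - of_int k\<bar>) * phi_sigma \<sigma> (u - of_int k)) \<le> A"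
    and phi_deriv_sum: "\<And>u (K::int set). finite K \<Longrightarrow>
      (\<Sum>k\<in>K. (1 + \<bar>u - of_int k\<bar>) * \<bar>deriv (phi_sigma \<sigma>) (u - of_int k)\<bar>) \<le> A"
begin

abbreviation "\<phi> \<equiv> phi_sigma \<sigma>"
abbreviation "\<phi>' \<equiv> deriv (phi_sigma \<sigma>)"

text \<open>A product weight, so that the weighted lattice sums factor into one-dimensional ones;
  it still dominates \<open>1 + norm u\<close>.\<close>

definition weight :: "real^'d \<Rightarrow> real" where
  "weight u = (\<Prod>i\<in>UNIV. 1 + \<bar>u $ i\<bar>)"

text \<open>The partial derivative of \<open>Psi_sigma\<close> in the i-th coordinate.\<close>

definition dPsi :: "'d \<Rightarrow> real^'d \<Rightarrow> real" where
  "dPsi i u = \<phi>' (u $ i) * (\<Prod>j\<in>UNIV - {i}. \<phi> (u $ j))"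

lemma Psi_nonneg: "0 \<le> Psi_sigma \<sigma> u"
  unfolding Psi_sigma_def by (rule prod_nonneg) (rule phi_nonneg)

lemma Psi_ge:
  fixes u :: "real^'d"
  assumes "\<And>i. \<bar>u $ i\<bar> \<le> 1"
  shows "c ^ CARD('d) \<le> Psi_sigma \<sigma> u"
proof -
  have "(\<Prod>i\<in>(UNIV::'d set). c) \<le> Psi_sigma \<sigma> u"
    unfolding Psi_sigma_def using c_pos assms by (intro prod_mono) (auto intro: phi_ge)
  then show ?thesis by simp
qed

lemma sum_Psi_ge:
  fixes x :: "real^'d"
  assumes "x \<in> cbox a b" and "\<And>i. 1 \<le> real n * (b $ i - a $ i)"
  shows "c ^ CARD('d) \<le> (\<Sum>k\<in>J_set a b n. Psi_sigma \<sigma> (real n *\<^sub>R x - k))"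
proof -
  obtain k where k: "k \<in> J_set a b n" "\<And>i. \<bar>(real n *\<^sub>R x - k) $ i\<bar> \<le> 1"
    using J_set_near[OF assms] by blast
  have "c ^ CARD('d) \<le> Psi_sigma \<sigma> (real n *\<^sub>R x - k)" by (rule Psi_ge[OF k(2)])
  also have "\<dots> \<le> (\<Sum>k\<in>J_set a b n. Psi_sigma \<sigma> (real n *\<^sub>R x - k))"
    by (rule member_le_sum[OF k(1)]) (auto simp: Psi_nonneg finite_J_set)
  finally show ?thesis .
qed

text \<open>Expanding the product yields 1, the linear terms and further nonnegative terms; the
  linear terms form the l1 norm, which dominates the Euclidean one.\<close>

lemma weight_ge: "1 + norm u \<le> weight u"
proof -
  have *: "1 + (\<Sum>i\<in>S. \<bar>u $ i\<bar>) \<le> (\<Prod>i\<in>S. 1 + \<bar>u $ i\<bar>)" for S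
  proof (induction S rule: infinite_finite_induct)
    case (insert i S)
    have "1 * \<bar>u $ i\<bar> \<le> (\<Prod>i\<in>S. 1 + \<bar>u $ i\<bar>) * \<bar>u $ i\<bar>"
      by (intro mult_right_mono prod_ge_1) auto
    then show ?case using insert by (simp add: algebra_simps)
  qed auto
  show ?thesis using *[of UNIV] norm_le_l1_cart[of u] by (simp add: weight_def)
qed

lemma sum_J_set_prod_le:
  fixes g :: "'d::finite \<Rightarrow> real \<Rightarrow> real" and a b :: "real^'d"
  assumes "\<And>i r. 0 \<le> g i r"
    and "\<And>i (K::int set). finite K \<Longrightarrow> (\<Sum>k\<in>K. g i (of_int k)) \<le> A"
  shows "(\<Sum>k\<in>J_set a b n. \<Prod>i\<in>UNIV. g i (k $ i)) \<le> A ^ CARD('d)"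
proof -
  have "(\<Sum>k\<in>J_set a b n. \<Prod>i\<in>UNIV. g i (k $ i)) = (\<Prod>i\<in>UNIV. \<Sum>r\<in>grid a b n i. g i r)"
    unfolding J_set_eq by (rule sum_prod_vec) (simp add: grid_def)
  also have "\<dots> \<le> (\<Prod>i\<in>(UNIV::'d set). A)"
  proof (rule prod_mono)
    fix i
    have "(\<Sum>r\<in>grid a b n i. g i r) = (\<Sum>k\<in>{\<lceil>real n * a $ i\<rceil>..\<lfloor>real n * b $ i\<rfloor>}. g i (of_int k))"
      unfolding grid_def by (subst sum.reindex) (auto simp: inj_on_def)
    also have "\<dots> \<le> A" by (rule assms(2)) simp
    finally show "0 \<le> (\<Sum>r\<in>grid a b n i. g i r) \<and> (\<Sum>r\<in>grid a b n i. g i r) \<le> A"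
      by (simp add: sum_nonneg assms(1))
  qed
  finally show ?thesis by simp
qed

lemma sum_weight_Psi_le:
  fixes u :: "real^'d"
  shows "(\<Sum>k\<in>J_set a b n. weight (u - k) * Psi_sigma \<sigma> (u - k)) \<le> A ^ CARD('d)"
proof -
  have "(\<Sum>k\<in>J_set a b n. \<Prod>i\<in>UNIV. (1 + \<bar>u $ i - k $ i\<bar>) * \<phi> (u $ i - k $ i)) \<le> A ^ CARD('d)"
    by (rule sum_J_set_prod_le[where g = "\<lambda>i r. (1 + \<bar>u $ i - r\<bar>) * \<phi> (u $ i - r)"])
      (auto intro: phi_sum mult_nonneg_nonneg[OF _ phi_nonneg])
  then show ?thesis by (simp add: weight_def Psi_sigma_def prod.distrib)
qed

lemma sum_weight_dPsi_le:
  fixes u :: "real^'d"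
  shows "(\<Sum>k\<in>J_set a b n. weight (u - k) * \<bar>dPsi i (u - k)\<bar>) \<le> A ^ CARD('d)"
proof -
  \<comment> \<open>Putting |\<phi>'| in coordinate i and \<phi> elsewhere turns
    |\<open>dPsi i\<close>| into a pure product, so \<open>sum_J_set_prod_le\<close>
    applies.\<close>
  define \<theta> where "\<theta> j = (if j = i then (\<lambda>x. \<bar>\<phi>' x\<bar>) else \<phi>)" for j
  have "(\<Sum>k\<in>J_set a b n. \<Prod>j\<in>UNIV. (1 + \<bar>u $ j - k $ j\<bar>) * \<theta> j (u $ j - k $ j)) \<le> A ^ CARD('d)"
    by (rule sum_J_set_prod_le[where g = "\<lambda>j r. (1 + \<bar>u $ j - r\<bar>) * \<theta> j (u $ j - r)"])
      (auto simp: \<theta>_def intro: phi_sum phi_deriv_sum mult_nonneg_nonneg[OF _ phi_nonneg])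
  moreover have "(\<Prod>j\<in>UNIV. \<theta> j (u $ j - k $ j)) = \<bar>dPsi i (u - k)\<bar>" for k
  proof -
    have "(\<Prod>j\<in>UNIV. \<theta> j (u $ j - k $ j))
        = \<bar>\<phi>' (u $ i - k $ i)\<bar> * (\<Prod>j\<in>UNIV - {i}. \<theta> j (u $ j - k $ j))"
      by (subst prod.remove[of _ i]) (auto simp: \<theta>_def)
    also have "(\<Prod>j\<in>UNIV - {i}. \<theta> j (u $ j - k $ j)) = (\<Prod>j\<in>UNIV - {i}. \<phi> (u $ j - k $ j))"
      by (rule prod.cong) (auto simp: \<theta>_def)
    finally show ?thesis by (simp add: dPsi_def abs_mult prod_nonneg phi_nonneg)
  qed
  ultimately show ?thesis by (simp add: weight_def prod.distrib)
qed

lemma Psi_has_derivative_along_line: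
  "((\<lambda>t. Psi_sigma \<sigma> (u + t *\<^sub>R v)) has_real_derivative
    (\<Sum>i\<in>UNIV. v $ i * dPsi i (u + t *\<^sub>R v))) (at t)"
proof -
  have "((\<lambda>t. \<Prod>i\<in>UNIV. \<phi> (u $ i + t * v $ i)) has_real_derivative
    (\<Sum>i\<in>UNIV. (\<phi>' (u $ i + t * v $ i) * (0 + 1 * v $ i)) * (\<Prod>j\<in>UNIV - {i}. \<phi> (u $ j + t * v $ j)))) (at t)"
    by (intro has_field_derivative_prod DERIV_chain2[where f = \<phi>] phi_deriv DERIV_add DERIV_const
        DERIV_cmult_right DERIV_ident)
  then show ?thesis by (simp add: Psi_sigma_def dPsi_def mult_ac)
qed

text \<open>\<open>F_op\<close> is a weighted mean of values of f with nonnegative weights. The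
  bound makes the supremum in the rate hypothesis a genuine one.\<close>

lemma F_op_abs_le:
  fixes a b x :: "real^'d"
  assumes wide: "\<And>i. 1 \<le> real n * (b $ i - a $ i)" and n: "1 \<le> n"
    and x: "x \<in> cbox a b" and f: "\<And>z. z \<in> cbox a b \<Longrightarrow> \<bar>f z\<bar> \<le> B"
  shows "\<bar>F_op \<sigma> a b n f x\<bar> \<le> B"
proof -
  define q where "q k = Psi_sigma \<sigma> (real n *\<^sub>R x - k)" for k
  have q0: "0 \<le> q k" for k by (simp add: q_def Psi_nonneg)
  have "0 < c ^ CARD('d)" using c_pos by simp
  also have "\<dots> \<le> (\<Sum>k\<in>J_set a b n. q k)" unfolding q_def by (rule sum_Psi_ge[OF x wide])
  finally have D: "0 < (\<Sum>k\<in>J_set a b n. q k)" .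
  have "\<bar>\<Sum>k\<in>J_set a b n. f ((1 / real n) *\<^sub>R k) * q k\<bar> \<le> (\<Sum>k\<in>J_set a b n. B * q k)"
    by (rule order_trans[OF sum_abs sum_mono])
      (use q0 in \<open>auto simp: abs_mult intro!: mult_right_mono f J_set_scaled_in_cbox n\<close>)
  then show ?thesis
    using D unfolding F_op_def q_def[symmetric] by (simp add: pos_divide_le_eq sum_distrib_left)
qed

text \<open>Since \<open>F_op\<close> reproduces constants, \<open>f\<close> may be replaced by \<open>f - f p\<close> when differentiating
  at the point \<open>p\<close>; this trades the factor \<open>sup \<bar>f\<bar>\<close> for \<open>modulus f (cbox a b) (1 / n)\<close>.\<close>

lemma F_op_diff_le:
  fixes a b x y :: "real^'d"
  assumes wide: "\<And>i. 1 \<le> real n * (b $ i - a $ i)" and n: "1 \<le> n"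
    and f: "continuous_on (cbox a b) f" and x: "x \<in> cbox a b" and y: "y \<in> cbox a b"
  defines "\<Gamma> \<equiv> A ^ CARD('d)" and "\<gamma> \<equiv> c ^ CARD('d)"
  shows "\<bar>F_op \<sigma> a b n f x - F_op \<sigma> a b n f y\<bar>
    \<le> real CARD('d) * (\<Gamma> / \<gamma> + (\<Gamma> / \<gamma>)\<^sup>2) * real n * dist x y * modulus f (cbox a b) (1 / real n)"
proof -
  define J where "J = J_set a b n"
  define v where "v = y - x"
  define \<omega> where "\<omega> = modulus f (cbox a b) (1 / real n)"
  define u where "u k t = (real n *\<^sub>R x - k) + t *\<^sub>R (real n *\<^sub>R v)" for k t
  define q where "q k t = Psi_sigma \<sigma> (u k t)" for k t
  define q' where "q' k t = (\<Sum>i\<in>UNIV. (real n *\<^sub>R v) $ i * dPsi i (u k t))" for k t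
  define g where "g k = f ((1 / real n) *\<^sub>R k)" for k
  define N where "N t = (\<Sum>k\<in>J. g k * q k t)" for t
  define N' where "N' t = (\<Sum>k\<in>J. g k * q' k t)" for t
  define D where "D t = (\<Sum>k\<in>J. q k t)" for t
  define D' where "D' t = (\<Sum>k\<in>J. q' k t)" for t
  \<comment> \<open>Each of the d coordinates of n v is at most n |v|, so S times \<Gamma> bounds
    the weighted sum of the derivatives \<open>q'\<close>.\<close>
  define S where "S = real CARD('d) * real n * norm v"
  have F_eq: "F_op \<sigma> a b n f (x + t *\<^sub>R v) = N t / D t" for t
    unfolding F_op_def N_def D_def J_def g_def q_def u_def by (simp add: algebra_simps)
  have dq: "(q k has_real_derivative q' k t) (at t)" for k t
    unfolding q_def q'_def u_def by (rule Psi_has_derivative_along_line)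
  have dN: "(N has_real_derivative N' t) (at t)" for t
    unfolding N_def[abs_def] N'_def by (intro DERIV_sum DERIV_cmult dq)
  have dD: "(D has_real_derivative D' t) (at t)" for t
    unfolding D_def[abs_def] D'_def by (intro DERIV_sum dq)
  have cb: "compact (cbox a b)" "convex (cbox a b)" by auto
  have line: "x + t *\<^sub>R v \<in> cbox a b" if "0 \<le> t" "t \<le> 1" for t
  proof -
    have "x + t *\<^sub>R v = (1 - t) *\<^sub>R x + t *\<^sub>R y" by (simp add: v_def algebra_simps)
    then show ?thesis using convexD_alt[OF cb(2) x y that] by simp
  qed
  have \<gamma>: "0 < \<gamma>" unfolding \<gamma>_def using c_pos by simp
  have Dge: "\<gamma> \<le> D t" if "0 \<le> t" "t \<le> 1" for t
    using sum_Psi_ge[OF line[OF that] wide]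
    unfolding D_def J_def q_def u_def \<gamma>_def by (simp add: algebra_simps)
  have \<omega>0: "0 \<le> \<omega>" unfolding \<omega>_def by (rule modulus_nonneg[OF cb(1) f]) (use x in auto)
  have w1: "1 \<le> weight z" for z :: "real^'d" using weight_ge[of z] norm_ge_zero[of z] by linarith
  have sum_q: "(\<Sum>k\<in>J. weight (u k t) * q k t) \<le> \<Gamma>" for t
  proof -
    have "u k t = (real n *\<^sub>R x + t *\<^sub>R (real n *\<^sub>R v)) - k" for k by (simp add: u_def)
    then show ?thesis unfolding J_def q_def \<Gamma>_def by (simp only: sum_weight_Psi_le)
  qed
  have sum_q': "(\<Sum>k\<in>J. weight (u k t) * \<bar>q' k t\<bar>) \<le> S * \<Gamma>" for t
  proof -
    have u_eq: "u k t = (real n *\<^sub>R x + t *\<^sub>R (real n *\<^sub>R v)) - k" for k by (simp add: u_def)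
    have "\<bar>q' k t\<bar> \<le> real n * norm v * (\<Sum>i\<in>UNIV. \<bar>dPsi i (u k t)\<bar>)" for k
      unfolding q'_def sum_distrib_left
      by (rule order_trans[OF sum_abs sum_mono])
        (auto simp: abs_mult intro!: mult_right_mono mult_left_mono component_le_norm_cart)
    then have "(\<Sum>k\<in>J. weight (u k t) * \<bar>q' k t\<bar>)
        \<le> (\<Sum>k\<in>J. weight (u k t) * (real n * norm v * (\<Sum>i\<in>UNIV. \<bar>dPsi i (u k t)\<bar>)))"
      using w1 by (intro sum_mono mult_left_mono) (auto intro: order_trans[OF zero_le_one])
    also have "\<dots> = real n * norm v * (\<Sum>k\<in>J. \<Sum>i\<in>UNIV. weight (u k t) * \<bar>dPsi i (u k t)\<bar>)"
      by (simp add: sum_distrib_left mult_ac)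
    also have "(\<Sum>k\<in>J. \<Sum>i\<in>UNIV. weight (u k t) * \<bar>dPsi i (u k t)\<bar>)
        = (\<Sum>i\<in>UNIV. \<Sum>k\<in>J. weight (u k t) * \<bar>dPsi i (u k t)\<bar>)" by (rule sum.swap)
    also have "real n * norm v * \<dots> \<le> real n * norm v * (\<Sum>i\<in>(UNIV::'d set). \<Gamma>)"
      unfolding u_eq J_def \<Gamma>_def by (intro mult_left_mono sum_mono sum_weight_dPsi_le) auto
    also have "\<dots> = S * \<Gamma>" by (simp add: S_def)
    finally show ?thesis .
  qed
  have deriv_le: "\<bar>(N' t * D t - N t * D' t) / (D t * D t)\<bar> \<le> \<omega> * S * (\<Gamma> / \<gamma> + (\<Gamma> / \<gamma>)\<^sup>2)"
    if t: "0 \<le> t" "t \<le> 1" for t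
  proof -
    \<comment> \<open>The constant to be subtracted: k/n has distance |\<open>u k t\<close>| / n
      from the current point, so \<open>g k - e\<close> costs \<omega> times 1 +
      |\<open>u k t\<close>|.\<close>
    define e where "e = f (x + t *\<^sub>R v)"
    have ge: "\<bar>g k - e\<bar> \<le> \<omega> * weight (u k t)" if k: "k \<in> J" for k
    proof -
      have "\<bar>g k - e\<bar> \<le> \<omega> * (1 + dist ((1 / real n) *\<^sub>R k) (x + t *\<^sub>R v) / (1 / real n))"
        unfolding g_def e_def \<omega>_def
        using k n by (intro diff_le_modulus_dilation cb f line t) (auto simp: J_def J_set_scaled_in_cbox)
      also have "dist ((1 / real n) *\<^sub>R k) (x + t *\<^sub>R v) / (1 / real n) = norm (u k t)"
      proof -
        have "u k t = - (real n *\<^sub>R ((1 / real n) *\<^sub>R k - (x + t *\<^sub>R v)))"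
          using n by (simp add: u_def algebra_simps)
        then show ?thesis by (simp add: dist_norm mult.commute)
      qed
      also have "\<omega> * (1 + norm (u k t)) \<le> \<omega> * weight (u k t)"
        by (intro mult_left_mono weight_ge \<omega>0)
      finally show ?thesis .
    qed
    have b1: "\<bar>N t - e * D t\<bar> \<le> \<omega> * \<Gamma>"
    proof -
      have "\<bar>N t - e * D t\<bar> = \<bar>\<Sum>k\<in>J. (g k - e) * q k t\<bar>"
        by (simp add: N_def D_def sum_distrib_left left_diff_distrib sum_subtractf)
      also have "\<dots> \<le> (\<Sum>k\<in>J. \<omega> * (weight (u k t) * q k t))"
        by (rule order_trans[OF sum_abs sum_mono])
          (auto simp: abs_mult q_def Psi_nonneg mult.assoc[symmetric] intro!: mult_right_mono ge)
      also have "\<dots> \<le> \<omega> * \<Gamma>"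
        unfolding sum_distrib_left[symmetric] by (intro mult_left_mono sum_q \<omega>0)
      finally show ?thesis .
    qed
    have b2: "\<bar>N' t - e * D' t\<bar> \<le> \<omega> * (S * \<Gamma>)"
    proof -
      have "\<bar>N' t - e * D' t\<bar> = \<bar>\<Sum>k\<in>J. (g k - e) * q' k t\<bar>"
        by (simp add: N'_def D'_def sum_distrib_left left_diff_distrib sum_subtractf)
      also have "\<dots> \<le> (\<Sum>k\<in>J. \<omega> * (weight (u k t) * \<bar>q' k t\<bar>))"
        by (rule order_trans[OF sum_abs sum_mono])
          (auto simp: abs_mult mult.assoc[symmetric] intro!: mult_right_mono ge)
      also have "\<dots> \<le> \<omega> * (S * \<Gamma>)"
        unfolding sum_distrib_left[symmetric] by (intro mult_left_mono sum_q' \<omega>0)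
      finally show ?thesis .
    qed
    have b3: "\<bar>D' t\<bar> \<le> S * \<Gamma>"
    proof -
      have "\<bar>D' t\<bar> \<le> (\<Sum>k\<in>J. 1 * \<bar>q' k t\<bar>)" unfolding D'_def by simp
      also have "\<dots> \<le> (\<Sum>k\<in>J. weight (u k t) * \<bar>q' k t\<bar>)"
        by (intro sum_mono mult_right_mono w1) auto
      finally show ?thesis using sum_q'[of t] by linarith
    qed
    have Dt: "0 < D t" using Dge[OF t] \<gamma> by linarith
    \<comment> \<open>Replacing N by N - e D and N' by N' - e D' leaves the numerator N' D - N D'
      unchanged, as the two products e D D' cancel.\<close>
    have "(N' t * D t - N t * D' t) / (D t * D t)
        = (N' t - e * D' t) / D t - (N t - e * D t) * D' t / (D t * D t)"
      using Dt by (simp add: field_simps)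
    also have "\<bar>\<dots>\<bar> \<le> \<bar>N' t - e * D' t\<bar> / D t + \<bar>N t - e * D t\<bar> * \<bar>D' t\<bar> / (D t * D t)"
      using Dt abs_triangle_ineq4[of "(N' t - e * D' t) / D t" "(N t - e * D t) * D' t / (D t * D t)"]
      by (simp add: abs_mult)
    also have "\<dots> \<le> \<omega> * (S * \<Gamma>) / \<gamma> + (\<omega> * \<Gamma>) * (S * \<Gamma>) / (\<gamma> * \<gamma>)"
    proof (intro add_mono frac_le mult_mono b1 b2 b3 Dge t)
      show "0 \<le> \<omega> * (S * \<Gamma>)" using b2 abs_ge_zero order_trans by blast
      show "0 \<le> \<omega> * \<Gamma>" using b1 abs_ge_zero order_trans by blast
      then show "0 \<le> \<omega> * \<Gamma> * (S * \<Gamma>)" using b3 abs_ge_zero order_trans by (metis mult_nonneg_nonneg)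
    qed (use \<gamma> Dt in auto)
    also have "\<dots> = \<omega> * S * (\<Gamma> / \<gamma> + (\<Gamma> / \<gamma>)\<^sup>2)"
      by (simp add: power2_eq_square field_simps)
    finally show ?thesis .
  qed
  obtain z where z: "0 < z" "z < 1"
    "N 1 / D 1 - N 0 / D 0 = (1 - 0) * ((N' z * D z - N z * D' z) / (D z * D z))"
  proof -
    have "((\<lambda>t. N t / D t) has_real_derivative (N' t * D t - N t * D' t) / (D t * D t)) (at t)"
      if "0 \<le> t" "t \<le> 1" for t
      using Dge[OF that] \<gamma> by (intro DERIV_divide dN dD) auto
    from MVT2[OF zero_less_one this] show ?thesis using that by blast
  qed
  have "\<bar>F_op \<sigma> a b n f x - F_op \<sigma> a b n f y\<bar> = \<bar>N 1 / D 1 - N 0 / D 0\<bar>"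
    using F_eq[of 0] F_eq[of 1] by (simp add: v_def abs_minus_commute)
  also have "\<dots> \<le> \<omega> * S * (\<Gamma> / \<gamma> + (\<Gamma> / \<gamma>)\<^sup>2)"
    unfolding z(3) using deriv_le[of z] z(1,2) by simp
  also have "\<dots> = real CARD('d) * (\<Gamma> / \<gamma> + (\<Gamma> / \<gamma>)\<^sup>2) * real n * dist x y * \<omega>"
    by (simp add: S_def v_def dist_norm norm_minus_commute)
  finally show ?thesis unfolding \<omega>_def .
qed

end

section \<open>From the conditions on \<sigma> to the inverse theorem\<close>

lemma sigma_conditions_imp_kernel:
  assumes s: "sigma_conditions \<sigma> \<alpha>" and al: "1 < \<alpha>" and M: "M_moment 1 (deriv (phi_sigma \<sigma>)) < top"
  obtains c A where "kernel \<sigma> c A"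
proof -
  obtain A1 where A1: "\<And>u (K::int set). finite K \<Longrightarrow>
      (\<Sum>k\<in>K. (1 + \<bar>u - of_int k\<bar>) * phi_sigma \<sigma> (u - of_int k)) \<le> A1"
    using phi_sigma_weighted_sum_bounded[OF s al] by blast
  obtain A2 where A2: "\<And>u (K::int set). finite K \<Longrightarrow>
      (\<Sum>k\<in>K. (1 + \<bar>u - of_int k\<bar>) * \<bar>deriv (phi_sigma \<sigma>) (u - of_int k)\<bar>) \<le> A2"
    using weighted_sum_bounded_if_M_moment[OF M continuous_on_deriv_phi_sigma[OF s]] by blast
  have "kernel \<sigma> ((\<sigma> 1 - 1 / 2) / 2) (max A1 A2)"
  proof
    show "(phi_sigma \<sigma> has_real_derivative deriv (phi_sigma \<sigma>) x) (at x)" for x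
      using phi_sigma_has_derivative[OF s, of x] DERIV_imp_deriv by metis
    show "0 \<le> phi_sigma \<sigma> x" for x
      using s by (intro phi_sigma_nonneg) (simp add: sigma_conditions_def)
    show "0 < (\<sigma> 1 - 1 / 2) / 2" using sigma_one_gt_half[OF s] by simp
    show "(\<sigma> 1 - 1 / 2) / 2 \<le> phi_sigma \<sigma> x" if "\<bar>x\<bar> \<le> 1" for x by (rule phi_sigma_ge[OF s that])
  qed (use A1 A2 in \<open>auto simp: le_max_iff_disj\<close>)
  then show ?thesis by (rule that)
qed

lemma eventually_wide:
  fixes a b :: "real^'d"
  assumes "\<forall>i. a $ i < b $ i"
  shows "\<forall>\<^sub>F n in sequentially. \<forall>i. 1 \<le> real n * (b $ i - a $ i)"
proof (rule eventually_all_finite)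
  fix i
  have "filterlim (\<lambda>n. real n * (b $ i - a $ i)) at_top sequentially"
    using assms by (intro filterlim_at_top_mult_tendsto_pos[OF tendsto_const] filterlim_real_sequentially) auto
  then show "\<forall>\<^sub>F n in sequentially. 1 \<le> real n * (b $ i - a $ i)"
    by (simp add: filterlim_at_top)
qed

theorem theorem3p1:
  fixes \<sigma> :: "real \<Rightarrow> real" and \<alpha> \<nu> :: real
    and a b :: "real^'d" and f :: "real^'d \<Rightarrow> real"
  assumes "sigma_conditions \<sigma> \<alpha>" and "\<alpha> > 1"
    and "M_moment 1 (deriv (phi_sigma \<sigma>)) < top"
    and "\<forall>i. a $ i < b $ i"
    and "continuous_on (cbox a b) f"
    and "0 < \<nu>" and "\<nu> < 1"
    and "(\<lambda>n::nat. SUP x\<in>cbox a b. \<bar>F_op \<sigma> a b n f x - f x\<bar>) \<in> O(\<lambda>n. real n powr (- \<nu>))"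
  shows "f \<in> Lip_class (cbox a b) \<nu>"
proof -
  obtain c A where "kernel \<sigma> c A" using sigma_conditions_imp_kernel[OF assms(1-3)] by blast
  then interpret kernel \<sigma> c A .
  note f = assms(5)
  define I where "I = cbox a b"
  define \<omega> where "\<omega> = modulus f I"
  define L where "L = real CARD('d) * (A ^ CARD('d) / c ^ CARD('d) + (A ^ CARD('d) / c ^ CARD('d))\<^sup>2)"
  have I: "compact I" "I \<noteq> {}" "continuous_on I f"
    using assms(4) f by (auto simp: I_def interval_ne_empty_cart less_imp_le)
  obtain B where B: "\<And>x. x \<in> I \<Longrightarrow> \<bar>f x\<bar> \<le> B"
    using compact_imp_bounded[OF compact_continuous_image[OF I(3,1)]] by (auto simp: bounded_iff)
  obtain C where C: "0 < C" "\<forall>\<^sub>F n in sequentially.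
      norm (SUP x\<in>cbox a b. \<bar>F_op \<sigma> a b n f x - f x\<bar>) \<le> C * norm (real n powr (-\<nu>))"
    using landau_o.bigE[OF assms(8)] by blast
  have "\<forall>\<^sub>F n in sequentially. 1 \<le> n \<and> (\<forall>i. 1 \<le> real n * (b $ i - a $ i)) \<and>
      norm (SUP x\<in>cbox a b. \<bar>F_op \<sigma> a b n f x - f x\<bar>) \<le> C * norm (real n powr (-\<nu>))"
    by (intro eventually_conj eventually_ge_at_top eventually_wide assms(4) C(2))
  then obtain n0 where n0: "\<And>n. n0 \<le> n \<Longrightarrow> 1 \<le> n" "\<And>n i. n0 \<le> n \<Longrightarrow> 1 \<le> real n * (b $ i - a $ i)"
    "\<And>n. n0 \<le> n \<Longrightarrow> norm (SUP x\<in>cbox a b. \<bar>F_op \<sigma> a b n f x - f x\<bar>) \<le> C * norm (real n powr (-\<nu>))"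
    unfolding eventually_sequentially by blast
  have close: "\<bar>F_op \<sigma> a b n f x - f x\<bar> \<le> C * real n powr (-\<nu>)" if n: "n0 \<le> n" and x: "x \<in> I" for n x
  proof -
    \<comment> \<open>Only for a bounded family does the rate on the supremum pass to each point
      x.\<close>
    have "bdd_above ((\<lambda>x. \<bar>F_op \<sigma> a b n f x - f x\<bar>) ` cbox a b)"
    proof (rule bdd_aboveI2[where M = "2 * B"])
      fix z assume z: "z \<in> cbox a b"
      have "\<bar>F_op \<sigma> a b n f z\<bar> \<le> B"
        by (rule F_op_abs_le[OF n0(2) n0(1) z]) (use n B in \<open>auto simp: I_def\<close>)
      then show "\<bar>F_op \<sigma> a b n f z - f z\<bar> \<le> 2 * B" using B[of z] z unfolding I_def by linarith
    qed
    then have "\<bar>F_op \<sigma> a b n f x - f x\<bar> \<le> (SUP x\<in>cbox a b. \<bar>F_op \<sigma> a b n f x - f x\<bar>)"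
      using x unfolding I_def by (intro cSUP_upper)
    then show ?thesis using n0(3)[OF n] by simp
  qed
  have "0 \<le> A" using phi_sum[of "{}"] by simp
  then have L0: "0 \<le> L" using c_pos by (simp add: L_def)
  \<comment> \<open>Triangle inequality through \<open>F_op\<close> at x and y: two approximation
    errors, hence 2 * C, plus the Bernstein-type term.\<close>
  have rec: "\<omega> \<delta> \<le> (2 * C) * real n powr (-\<nu>) + L * real n * \<delta> * \<omega> (1 / real n)"
    if n: "n0 \<le> n" and \<delta>: "0 < \<delta>" for n \<delta>
    unfolding \<omega>_def
  proof (rule modulus_le[OF I(2)])
    fix x y assume xy: "x \<in> I" "y \<in> I" "dist x y \<le> \<delta>"
    have "\<bar>F_op \<sigma> a b n f x - F_op \<sigma> a b n f y\<bar> \<le> L * real n * dist x y * modulus f I (1 / real n)"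
      unfolding L_def I_def by (rule F_op_diff_le) (use n0 n f xy in \<open>auto simp: I_def\<close>)
    also have "\<dots> \<le> L * real n * \<delta> * modulus f I (1 / real n)"
      using L0 xy(3) modulus_nonneg[OF I(1,3,2), of "1 / real n"]
      by (intro mult_right_mono mult_left_mono) auto
    finally show "\<bar>f x - f y\<bar> \<le> (2 * C) * real n powr (-\<nu>) + L * real n * \<delta> * modulus f I (1 / real n)"
      using close[OF n xy(1)] close[OF n xy(2)] by linarith
  qed (use \<delta> in simp)
  have "\<exists>K. \<forall>\<delta>. 0 < \<delta> \<and> \<delta> \<le> 1 / real n0 \<longrightarrow> \<omega> \<delta> \<le> K * \<delta> powr \<nu>"
  proof (rule berens_lorentz[OF _ assms(6,7) L0 _ _ rec])
    show "\<omega> s \<le> \<omega> t" if "0 < s" "s \<le> t" for s t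
      unfolding \<omega>_def using that by (intro modulus_mono I) auto
  qed (use C n0 in auto)
  then obtain K where K: "\<And>\<delta>. 0 < \<delta> \<Longrightarrow> \<delta> \<le> 1 / real n0 \<Longrightarrow> \<omega> \<delta> \<le> K * \<delta> powr \<nu>" by blast
  have "\<omega> \<in> O[at_right 0](\<lambda>\<delta>. \<delta> powr \<nu>)"
  proof (rule bigoI)
    have "0 < 1 / real n0" using n0(1)[of n0] by simp
    then show "\<forall>\<^sub>F \<delta> in at_right 0. norm (\<omega> \<delta>) \<le> K * norm (\<delta> powr \<nu>)"
      unfolding eventually_at_right_field
    proof (intro exI conjI allI impI)
      fix \<delta> :: real assume "0 < \<delta>" "\<delta> < 1 / real n0"
      then show "norm (\<omega> \<delta>) \<le> K * norm (\<delta> powr \<nu>)"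
        using K[of \<delta>] modulus_nonneg[OF I(1,3,2), of \<delta>] by (simp add: \<omega>_def)
    qed
  qed
  then show ?thesis using f by (simp add: Lip_class_def \<omega>_def I_def)
qed

end
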